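(* Let $(G,\mathcal{B},\mathcal{O})$ be a topological graph. Then $(G,\mathcal{B},\mathcal{O})$ is connected if and only if $G$ is path connected.
   Context: All graphs are finite and simple. For a vertex $x$ of a graph $G=(V,E)$, the unit sphere $S(x)$ is the subgraph of $G$ generated (induced) by all vertices adjacent to $x$. The intersection of two subgraphs is the subgraph formed by their common vertices and common edges; a subgraph is also regarded as the set of its vertices when speaking of topologies on $V$. Dimension: $\dim(\emptyset)=-1$ and inductively $\dim(G)=\frac{1}{|V|}\sum_{x\in V}(1+\dim(S(x)))$. Homotopy: the one-point graph $K_1$ is contractible. A homotopy extension of a graph selects a contractible (induced) subgraph $H$ and adds a new vertex $z$ connected exactly to all vertices of $H$ (so $S(z)=H$). The reverse step removes a vertex $z$ with contractible unit sphere $S(z)$, together with all edges at $z$. Two graphs are homotopic if one can be obtained from the other by a finite sequence of such steps; a graph is contractible if it is homotopic to $K_1$. (This is an inductive definition.) Graph topology: two subgraphs $A,B$ satisfy the dimension assumption if $\dim(A\cap B)\ge \min(\dim(A),\dim(B))$, where the dimensions are those of these subgraphs as graphs themselves. A topology $\mathcal{O}$ on $V$ is a graph topology on $G=(V,E)$ if it has a sub-base $\mathcal{B}$ consisting of contractible subgraphs of $G$ such that (i) the intersection of any two elements of $\mathcal{B}$ satisfying the dimension assumption is contractible; (ii) every edge of $G$ is contained in some $B\in\mathcal{B}$; (iii) the nerve graph $\mathcal{G}=(\mathcal{B},\mathcal{E})$, whose vertices are the elements of $\mathcal{B}$ and whose edges are the pairs of distinct $A,B\in\mathcal{B}$ satisfying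 the dimension assumption, is homotopic to $G$. A graph with such a topology, written $(G,\mathcal{B},\mathcal{O})$, is a topological graph. Connectedness: $G=(V,E)$ is path connected if for any two vertices $x,y$ there is a path $x=x_0,x_1,\dots,x_n=y$ with $(x_i,x_{i+1})\in E$. The topological graph $(G,\mathcal{B},\mathcal{O})$ is connected if $\mathcal{B}$ cannot be written as a union of two nonempty sets $\mathcal{B}_1,\mathcal{B}_2$ which have no common intersection, i.e. such that $B_1\cap B_2=\emptyset$ for all $B_1\in\mathcal{B}_1$, $B_2\in\mathcal{B}_2$. *)

theory Defs
  imports
    "HOL-Analysis.Abstract_Topology"
    "Graph_Theory.Pair_Digraph"
    "Graph_Theory.Digraph_Component"
    "Graph_Theory.Digraph_Isomorphism"
    "Graph_Theory.Vertex_Walk"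
begin

text \<open>
  A finite simple graph is a \<open>pair_graph\<close>: a finite, symmetric, loop-free set of arcs given
  as pairs of vertices. The edge \<open>{x, y}\<close> is represented by the two arcs \<open>(x, y)\<close> and \<open>(y, x)\<close>.
  The empty graph is a \<open>pair_graph\<close>.
\<close>

definition generated_graph :: "'a pair_pre_digraph \<Rightarrow> 'a set \<Rightarrow> 'a pair_pre_digraph" where
  "generated_graph G U = \<lparr>pverts = U, parcs = parcs G \<inter> (U \<times> U)\<rparr>"

definition unit_sphere :: "'a pair_pre_digraph \<Rightarrow> 'a \<Rightarrow> 'a pair_pre_digraph" where
  "unit_sphere G x = generated_graph G {y \<in> pverts G. (x, y) \<in> parcs G}"

definition graph_inter ::
    "'a pair_pre_digraph \<Rightarrow> 'a pair_pre_digraph \<Rightarrow> 'a pair_pre_digraph" where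
  "graph_inter A B = \<lparr>pverts = pverts A \<inter> pverts B, parcs = parcs A \<inter> parcs B\<rparr>"

lemma pair_graph_unit_sphere:
  assumes "pair_graph G"
  shows "pair_graph (unit_sphere G x)"
proof -
  interpret pair_graph G by (rule assms)
  show ?thesis
  proof
    show "symmetric (with_proj (unit_sphere G x))"
      using arcs_symmetric
      by (auto simp: symmetric_def unit_sphere_def generated_graph_def intro!: symI)
  qed (auto simp: unit_sphere_def generated_graph_def dest: no_loops)
qed

lemma card_unit_sphere_less:
  assumes "pair_graph G" "x \<in> pverts G"
  shows "card (pverts (unit_sphere G x)) < card (pverts G)"
proof -
  interpret pair_graph G by (rule assms(1))
  have "(x, x) \<notin> parcs G" using no_loops by force
  then show ?thesis
    using assms(2) unfolding unit_sphere_def generated_graph_def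
    by (auto intro!: psubset_card_mono)
qed

text \<open>The value 0 on structures that are not graphs only serves to make the recursion total.\<close>

function graph_dim :: "'a pair_pre_digraph \<Rightarrow> real" where
  "graph_dim G =
     (if \<not> pair_graph G then 0
      else if pverts G = {} then - 1
      else (\<Sum>x\<in>pverts G. 1 + graph_dim (unit_sphere G x)) / real (card (pverts G)))"
  by auto
termination
  by (relation "measure (\<lambda>G. card (pverts G))") (auto intro: card_unit_sphere_less)

declare graph_dim.simps [simp del]

definition one_point_graph :: "'a \<Rightarrow> 'a pair_pre_digraph" where
  "one_point_graph v = \<lparr>pverts = {v}, parcs = {}\<rparr>"

definition graph_extension ::
    "'a pair_pre_digraph \<Rightarrow> 'a pair_pre_digraph \<Rightarrow> 'a \<Rightarrow> 'a pair_pre_digraph" where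
  "graph_extension G H z =
     \<lparr>pverts = insert z (pverts G),
      parcs = parcs G \<union> ({z} \<times> pverts H) \<union> (pverts H \<times> {z})\<rparr>"

definition remove_vertex :: "'a pair_pre_digraph \<Rightarrow> 'a \<Rightarrow> 'a pair_pre_digraph" where
  "remove_vertex G z = generated_graph G (pverts G - {z})"

text \<open>
  \<open>homotopy_seq G K\<close>: the graph \<open>K\<close> arises from \<open>G\<close> by finitely many steps. Contractibility of
  \<open>H\<close> is the case of a sequence leading from a one-point graph to \<open>H\<close>, so both notions are
  generated by the same induction.
\<close>

inductive homotopy_seq :: "'a pair_pre_digraph \<Rightarrow> 'a pair_pre_digraph \<Rightarrow> bool" where
  refl: "pair_graph G \<Longrightarrow> homotopy_seq G G"
| extend: "\<lbrakk>homotopy_seq G K; induced_subgraph (with_proj H) (with_proj K);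
            homotopy_seq (one_point_graph v) H; z \<notin> pverts K\<rbrakk>
           \<Longrightarrow> homotopy_seq G (graph_extension K H z)"
| remove: "\<lbrakk>homotopy_seq G K; z \<in> pverts K;
            homotopy_seq (one_point_graph v) (unit_sphere K z)\<rbrakk>
           \<Longrightarrow> homotopy_seq G (remove_vertex K z)"

text \<open>
  A sequence of steps may need more fresh vertices than the vertex type offers, and a graph has
  to be compared with its nerve, whose vertices have another type. Hence graphs are first replaced
  by isomorphic copies with vertices in \<^typ>\<open>nat\<close>.
\<close>

definition homotopic :: "'a pair_pre_digraph \<Rightarrow> 'b pair_pre_digraph \<Rightarrow> bool" where
  "homotopic G H \<longleftrightarrow>
     (\<exists>(G' :: nat pair_pre_digraph) (H' :: nat pair_pre_digraph).
        digraph_iso (with_proj G) (with_proj G') \<and>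
        digraph_iso (with_proj H) (with_proj H') \<and>
        homotopy_seq G' H')"

definition contractible_graph :: "'a pair_pre_digraph \<Rightarrow> bool" where
  "contractible_graph G \<longleftrightarrow> homotopic (one_point_graph (0 :: nat)) G"

definition dimension_assumption :: "'a pair_pre_digraph \<Rightarrow> 'a pair_pre_digraph \<Rightarrow> bool" where
  "dimension_assumption A B \<longleftrightarrow>
     graph_dim (graph_inter A B) \<ge> min (graph_dim A) (graph_dim B)"

definition nerve_graph ::
    "'a pair_pre_digraph set \<Rightarrow> 'a pair_pre_digraph pair_pre_digraph" where
  "nerve_graph \<B> =
     \<lparr>pverts = \<B>,
      parcs = {(A, B). A \<in> \<B> \<and> B \<in> \<B> \<and> A \<noteq> B \<and> dimension_assumption A B}\<rparr>"

text \<open>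
  Subgraphs need not be induced. As \<open>subgraph\<close> is a notion for digraphs, \<open>pair_graph\<close> is required
  of the subgraphs separately. The union of a sub-base is the whole space: the topology
  \<open>topology_generated_by \<S>\<close> lives on \<open>\<Union>\<S>\<close>, so the conditions on \<open>\<O>\<close> force the
  elements of \<open>\<B>\<close> to cover all vertices, isolated ones included.
\<close>

definition topological_graph ::
    "'a pair_pre_digraph \<Rightarrow> 'a pair_pre_digraph set \<Rightarrow> 'a topology \<Rightarrow> bool" where
  "topological_graph G \<B> \<O> \<longleftrightarrow>
     pair_graph G \<and>
     topspace \<O> = pverts G \<and>
     \<O> = topology_generated_by (pverts ` \<B>) \<and>
     (\<forall>B\<in>\<B>. pair_graph B \<and> subgraph (with_proj B) (with_proj G) \<and> contractible_graph B) \<and>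
     (\<forall>A\<in>\<B>. \<forall>B\<in>\<B>. dimension_assumption A B \<longrightarrow> contractible_graph (graph_inter A B)) \<and>
     (\<forall>e\<in>parcs G. \<exists>B\<in>\<B>. e \<in> parcs B) \<and>
     homotopic (nerve_graph \<B>) G"

definition path_connected_graph :: "'a pair_pre_digraph \<Rightarrow> bool" where
  "path_connected_graph G \<longleftrightarrow>
     (\<forall>x\<in>pverts G. \<forall>y\<in>pverts G. \<exists>p. vwalk p (with_proj G) \<and> hd p = x \<and> last p = y)"

definition connected_topological_graph ::
    "'a pair_pre_digraph \<Rightarrow> 'a pair_pre_digraph set \<Rightarrow> 'a topology \<Rightarrow> bool" where
  "connected_topological_graph G \<B> \<O> \<longleftrightarrow>
     \<not> (\<exists>\<B>1 \<B>2. \<B> = \<B>1 \<union> \<B>2 \<and> \<B>1 \<noteq> {} \<and> \<B>2 \<noteq> {} \<and>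
          (\<forall>B1\<in>\<B>1. \<forall>B2\<in>\<B>2. pverts (graph_inter B1 B2) = {}))"

end

theory Submission
  imports Defs
begin

text \<open>
  Contractible graphs are connected, because both kinds of homotopy step preserve connectedness.
  Hence every component of \<open>G\<close> which meets an element of the sub-base contains it,
  so a splitting of \<open>G\<close> into components splits the sub-base. Conversely, the
  elements of the sub-base cover all vertices and edges, so a splitting of the sub-base leaves no
  edge of \<open>G\<close> between the two parts.
\<close>

text \<open>
  Connectedness in terms of edge-invariant predicates: this form needs no surgery on walks
  when a vertex is added or removed.
\<close>

definition invariantly_connected :: "'a pair_pre_digraph \<Rightarrow> bool" where
  "invariantly_connected G \<longleftrightarrow>
     pverts G \<noteq> {} \<and>
     (\<forall>P :: 'a \<Rightarrow> bool. (\<forall>a b. (a, b) \<in> parcs G \<longrightarrow> P a = P b) \<longrightarrow>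
        (\<forall>x\<in>pverts G. \<forall>y\<in>pverts G. P x = P y))"

lemma invariantly_connectedI:
  assumes "pverts G \<noteq> {}"
    and "\<And>P x y. \<lbrakk>\<And>a b. (a, b) \<in> parcs G \<Longrightarrow> P a = P b; x \<in> pverts G; y \<in> pverts G\<rbrakk>
      \<Longrightarrow> P x = (P y :: bool)"
  shows "invariantly_connected G"
  unfolding invariantly_connected_def
proof (intro conjI allI impI ballI)
  fix P :: "'a \<Rightarrow> bool" and x y
  assume inv: "\<forall>a b. (a, b) \<in> parcs G \<longrightarrow> P a = P b" and xy: "x \<in> pverts G" "y \<in> pverts G"
  show "P x = P y" using inv[rule_format] xy by (rule assms(2))
qed (rule assms(1))

lemma invariantly_connectedD:
  assumes "invariantly_connected G"
    and "\<And>a b. (a, b) \<in> parcs G \<Longrightarrow> P a = (P b :: bool)"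
    and "x \<in> pverts G" "y \<in> pverts G"
  shows "P x = P y"
proof -
  have "(\<forall>a b. (a, b) \<in> parcs G \<longrightarrow> P a = P b) \<longrightarrow> (\<forall>x\<in>pverts G. \<forall>y\<in>pverts G. P x = P y)"
    using conjunct2[OF assms(1)[unfolded invariantly_connected_def]] by (rule spec)
  moreover have "\<forall>a b. (a, b) \<in> parcs G \<longrightarrow> P a = P b" by (intro allI impI assms(2))
  ultimately have "\<forall>x\<in>pverts G. \<forall>y\<in>pverts G. P x = P y" by (rule mp)
  with assms(3,4) show ?thesis by (elim ballE) auto
qed

lemma invariantly_connected_nonempty: "invariantly_connected G \<Longrightarrow> pverts G \<noteq> {}"
  by (simp add: invariantly_connected_def)

lemma invariantly_connected_one_point: "invariantly_connected (one_point_graph v)"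
  by (auto simp: invariantly_connected_def one_point_graph_def)

section \<open>Graphs and their connectedness under homotopy steps\<close>

lemma pair_graph_generated_graph:
  assumes "pair_graph G" "U \<subseteq> pverts G"
  shows "pair_graph (generated_graph G U)"
proof -
  interpret pair_graph G by (rule assms(1))
  show ?thesis
  proof
    show "symmetric (with_proj (generated_graph G U))"
      using arcs_symmetric by (auto simp: symmetric_def generated_graph_def intro!: symI)
    show "finite (pverts (generated_graph G U))"
      using finite_subset[OF assms(2) pair_finite_verts] by (simp add: generated_graph_def)
  qed (auto simp: generated_graph_def dest: no_loops)
qed

lemma pair_graph_extension:
  assumes "pair_graph G" "pverts H \<subseteq> pverts G" "z \<notin> pverts G"
  shows "pair_graph (graph_extension G H z)"
proof -
  interpret pair_graph G by (rule assms(1))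
  have "finite (pverts H)" using assms(2) pair_finite_verts by (rule finite_subset)
  \<comment> \<open>If \<open>z\<close> lay in \<open>H\<close>, the new arcs would include a loop
    at \<open>z\<close>.\<close>
  moreover have "z \<notin> pverts H" using assms by auto
  ultimately show ?thesis
  proof (unfold_locales, goal_cases)
    case 6
    show ?case
      using arcs_symmetric by (auto simp: symmetric_def graph_extension_def intro!: symI)
  qed (use assms(2) in \<open>auto simp: graph_extension_def dest: no_loops in_arcsD1 in_arcsD2\<close>)
qed

text \<open>The rules demand a graph only at the start of a sequence. Removing a vertex is analysed
  with symmetric arcs and without loops, so these properties have to be carried to every later
  graph.\<close>

lemma homotopy_seq_pair_graph:
  assumes "homotopy_seq G K"
  shows "pair_graph K"
  using assms
proof induction
  case (extend G K H v z)
  have "pverts H \<subseteq> pverts K"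
    using extend.hyps(2) by (auto simp: induced_subgraph_def subgraph_def)
  with extend show ?case by (intro pair_graph_extension)
next
  case (remove G K z v)
  then show ?case unfolding remove_vertex_def by (intro pair_graph_generated_graph) auto
qed

text \<open>The new vertex is joined to some \<open>h\<close> of the old graph, so any invariant
  takes at \<open>z\<close> the value that it has throughout \<open>K\<close>. Connectedness
  survives because the base \<open>H\<close> offers such an \<open>h\<close>.\<close>

lemma invariantly_connected_extension:
  assumes "invariantly_connected K" "pverts H \<subseteq> pverts K" "pverts H \<noteq> {}"
  shows "invariantly_connected (graph_extension K H z)"
proof (rule invariantly_connectedI)
  fix P :: "'a \<Rightarrow> bool" and x y
  assume inv: "P a = P b" if "(a, b) \<in> parcs (graph_extension K H z)" for a b
  assume xy: "x \<in> pverts (graph_extension K H z)" "y \<in> pverts (graph_extension K H z)"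
  obtain h where h: "h \<in> pverts H" using assms(3) by auto
  have "P u = P h" if "u \<in> pverts (graph_extension K H z)" for u
  proof (cases "u \<in> pverts K")
    case True
    show ?thesis
    proof (rule invariantly_connectedD[OF assms(1) _ True])
      show "P a = P b" if "(a, b) \<in> parcs K" for a b
        using that by (intro inv) (simp add: graph_extension_def)
    qed (use h assms(2) in auto)
  next
    case False
    with that have "u = z" by (simp add: graph_extension_def)
    with h show ?thesis by (intro inv) (simp add: graph_extension_def)
  qed
  from this[OF xy(1)] this[OF xy(2)] show "P x = P y" by simp
qed (simp add: graph_extension_def)

text \<open>A path through \<open>z\<close> enters and leaves via the sphere, and can be rerouted
  inside the connected sphere. For predicates: an invariant of the remaining graph is constant on
  the sphere, and giving \<open>z\<close> this constant value extends it to an invariant of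
  \<open>K\<close>.\<close>

lemma invariantly_connected_remove:
  assumes "pair_graph K" "invariantly_connected K" "invariantly_connected (unit_sphere K z)"
  shows "invariantly_connected (remove_vertex K z)"
proof (rule invariantly_connectedI)
  interpret pair_graph K by (rule assms(1))
  obtain s where s: "s \<in> pverts (unit_sphere K z)"
    using invariantly_connected_nonempty[OF assms(3)] by auto
  then have sK: "s \<in> pverts K" "(z, s) \<in> parcs K"
    by (auto simp: unit_sphere_def generated_graph_def)
  \<comment> \<open>Hence \<open>z\<close> is not in its own sphere: \<open>s\<close> survives the
    removal, and so do all arcs of the sphere.\<close>
  have nl: "(z, z) \<notin> parcs K" using no_loops by force
  with sK show "pverts (remove_vertex K z) \<noteq> {}"
    by (auto simp: remove_vertex_def generated_graph_def)
  fix P :: "'a \<Rightarrow> bool" and x y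
  assume inv: "P a = P b" if "(a, b) \<in> parcs (remove_vertex K z)" for a b
  assume xy: "x \<in> pverts (remove_vertex K z)" "y \<in> pverts (remove_vertex K z)"
  have sphere: "P u = P s" if "u \<in> pverts (unit_sphere K z)" for u
  proof (rule invariantly_connectedD[OF assms(3) _ that s])
    show "P a = P b" if "(a, b) \<in> parcs (unit_sphere K z)" for a b
      using that nl by (intro inv) (auto simp: unit_sphere_def remove_vertex_def generated_graph_def)
  qed
  \<comment> \<open>The value \<open>P z\<close> is arbitrary, since no arc at \<open>z\<close> is
    left to constrain it. It is replaced by the value on the sphere; \<open>x\<close> and
    \<open>y\<close> differ from \<open>z\<close> and are not affected.\<close>
  define Q where "Q = P(z := P s)"
  have "Q x = Q y"
  proof (rule invariantly_connectedD[OF assms(2)])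
    fix a b assume ab: "(a, b) \<in> parcs K"
    then have ba: "(b, a) \<in> parcs K" using arcs_symmetric by auto
    note V = in_arcsD1[OF ab] in_arcsD2[OF ab]
    consider "a = z" | "b = z" | "a \<noteq> z" "b \<noteq> z" by auto
    then show "Q a = Q b"
    proof cases
      case 1
      then have "b \<in> pverts (unit_sphere K z)"
        using ab V by (simp add: unit_sphere_def generated_graph_def)
      with 1 sphere show ?thesis by (simp add: Q_def)
    next
      case 2
      then have "a \<in> pverts (unit_sphere K z)"
        using ba V by (simp add: unit_sphere_def generated_graph_def)
      with 2 sphere show ?thesis by (simp add: Q_def)
    next
      case 3
      then have "P a = P b"
        using ab V by (intro inv) (simp add: remove_vertex_def generated_graph_def)
      with 3 show ?thesis by (simp add: Q_def)
    qed
  qed (use xy in \<open>auto simp: remove_vertex_def generated_graph_def\<close>)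
  then show "P x = P y"
    using xy by (simp add: Q_def remove_vertex_def generated_graph_def)
qed

text \<open>The starting graph is left general and its connectedness is a premise of the induction.
  Thus the induction hypotheses also apply to the sequences that lead from a one-point graph to the
  base \<open>H\<close> or to the unit sphere.\<close>

lemma homotopy_seq_invariantly_connected:
  assumes "homotopy_seq G K" "invariantly_connected G"
  shows "invariantly_connected K"
  using assms
proof induction
  case (extend G K H v z)
  have "pverts H \<subseteq> pverts K"
    using extend.hyps(2) by (auto simp: induced_subgraph_def subgraph_def)
  moreover have "pverts H \<noteq> {}"
    by (intro invariantly_connected_nonempty extend.IH(2) invariantly_connected_one_point)
  ultimately show ?case
    using extend.IH(1) extend.prems by (simp add: invariantly_connected_extension)
next
  case (remove G K z v)
  have "pair_graph K" using remove.hyps(1) by (rule homotopy_seq_pair_graph)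
  moreover have "invariantly_connected (unit_sphere K z)"
    using invariantly_connected_one_point by (rule remove.IH(2))
  ultimately show ?case
    using remove.IH(1) remove.prems by (simp add: invariantly_connected_remove)
qed

section \<open>Transfer along isomorphisms\<close>

lemma digraph_iso_with_projE:
  assumes "digraph_iso (with_proj A) (with_proj B)"
  obtains f where "inj_on f (pverts A)" "pverts B = f ` pverts A"
    "parcs B = map_prod f f ` parcs A" "pair_wf_digraph A"
proof -
  obtain h where h: "pre_digraph.digraph_isomorphism (with_proj A) h"
    and B: "with_proj B = app_iso h (with_proj A)"
    using assms by (auto simp: digraph_iso_def)
  let ?f = "iso_verts h"
  have pv: "pverts B = ?f ` pverts A"
    using arg_cong[OF B, of verts] by simp
  have pa: "parcs B = iso_arcs h ` parcs A"
    using arg_cong[OF B, of arcs] by simp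
  \<comment> \<open>An isomorphism carries its own tail and head maps for the target. Here they must
    be the projections, so its action on arcs is determined by that on vertices.\<close>
  have th: "iso_tail h = fst" "iso_head h = snd"
    using arg_cong[OF B, of tail] arg_cong[OF B, of head] by simp_all
  have "iso_arcs h e = map_prod ?f ?f e" if "e \<in> parcs A" for e
    using h that th by (auto simp: pre_digraph.digraph_isomorphism_def prod_eq_iff)
  then have "parcs B = map_prod ?f ?f ` parcs A" using pa by simp
  moreover have "inj_on ?f (pverts A)" "pair_wf_digraph A"
    using h by (auto simp: pre_digraph.digraph_isomorphism_def wf_digraph_wp_iff)
  ultimately show ?thesis using pv that by blast
qed

text \<open>Invariants are pulled back along \<open>f\<close> in one direction and along its inverse
  on the vertices in the other; the inverse is legitimate at the ends of arcs because
  \<open>A\<close> is well-formed. Both directions are used: forward into the copy of the one-point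
  graph over \<nat>, and back from the copy of a contractible graph.\<close>

lemma digraph_iso_invariantly_connected_iff:
  assumes "digraph_iso (with_proj A) (with_proj B)"
  shows "invariantly_connected A \<longleftrightarrow> invariantly_connected B"
proof -
  obtain f where f: "inj_on f (pverts A)" "pverts B = f ` pverts A"
    "parcs B = map_prod f f ` parcs A" and wf: "pair_wf_digraph A"
    using assms by (rule digraph_iso_with_projE)
  interpret pair_wf_digraph A by (rule wf)
  show ?thesis
  proof
    assume A: "invariantly_connected A"
    show "invariantly_connected B"
    proof (rule invariantly_connectedI)
      show "pverts B \<noteq> {}" using invariantly_connected_nonempty[OF A] f by simp
      fix P :: "'b \<Rightarrow> bool" and x y
      assume inv: "P a = P b" if "(a, b) \<in> parcs B" for a b
      assume "x \<in> pverts B" "y \<in> pverts B"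
      then obtain u v where uv: "u \<in> pverts A" "v \<in> pverts A" "x = f u" "y = f v"
        using f by auto
      have "(P \<circ> f) u = (P \<circ> f) v"
      proof (rule invariantly_connectedD[OF A _ uv(1,2)])
        fix a b assume "(a, b) \<in> parcs A"
        then have "(f a, f b) \<in> parcs B" using f(3) by force
        then show "(P \<circ> f) a = (P \<circ> f) b" using inv by simp
      qed
      then show "P x = P y" using uv by simp
    qed
  next
    assume B: "invariantly_connected B"
    show "invariantly_connected A"
    proof (rule invariantly_connectedI)
      show "pverts A \<noteq> {}" using invariantly_connected_nonempty[OF B] f by simp
      fix P :: "'a \<Rightarrow> bool" and x y
      assume inv: "P a = P b" if "(a, b) \<in> parcs A" for a b
      assume xy: "x \<in> pverts A" "y \<in> pverts A"
      let ?g = "the_inv_into (pverts A) f"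
      have g: "?g (f u) = u" if "u \<in> pverts A" for u
        using f(1) that by (rule the_inv_into_f_f)
      have "P (?g (f x)) = P (?g (f y))"
      proof (rule invariantly_connectedD[OF B, of "P \<circ> ?g", unfolded o_def])
        fix a b assume "(a, b) \<in> parcs B"
        then obtain u v where "(u, v) \<in> parcs A" "a = f u" "b = f v" using f by auto
        then show "P (?g a) = P (?g b)" using g inv[of u v] in_arcsD1 in_arcsD2 by simp
      qed (use f xy in auto)
      then show "P x = P y" using g xy by simp
    qed
  qed
qed

lemma contractible_graph_invariantly_connected:
  assumes "contractible_graph G"
  shows "invariantly_connected G"
proof -
  obtain G' H' :: "nat pair_pre_digraph" where
    iso: "digraph_iso (with_proj (one_point_graph (0 :: nat))) (with_proj G')"
      "digraph_iso (with_proj G) (with_proj H')"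
    and seq: "homotopy_seq G' H'"
    using assms unfolding contractible_graph_def homotopic_def by blast
  have "invariantly_connected G'"
    using digraph_iso_invariantly_connected_iff[OF iso(1)] invariantly_connected_one_point
    by (rule iffD1)
  with seq have "invariantly_connected H'" by (rule homotopy_seq_invariantly_connected)
  then show ?thesis by (rule iffD2[OF digraph_iso_invariantly_connected_iff[OF iso(2)]])
qed

section \<open>Walks and invariant predicates\<close>

lemma vwalk_snoc:
  assumes "vwalk p G" "(last p, b) \<in> arcs_ends G" "b \<in> verts G"
  shows "vwalk (p @ [b]) G"
  using assms by (auto simp: vwalk_def set_vwalk_arcs_snoc)

lemma vwalk_invariant:
  assumes "vwalk p G" "\<And>a b. (a, b) \<in> arcs_ends G \<Longrightarrow> P a = P b"
  shows "P (hd p) = P (last p)"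
  using assms(1)
proof induction
  case (Cons u v es)
  from assms(2)[OF Cons(1)] Cons(2) show ?case by simp
qed simp

text \<open>An invariant propagates along a walk. Conversely, reachability from \<open>x\<close> is
  itself an invariant, because arcs can be reversed. The empty graph is listed apart: it is path
  connected vacuously, but \<open>invariantly_connected\<close> asks for a vertex.\<close>

lemma path_connected_graph_iff_invariant:
  assumes "pair_graph G"
  shows "path_connected_graph G \<longleftrightarrow> pverts G = {} \<or> invariantly_connected G"
proof -
  interpret pair_graph G by (rule assms)
  show ?thesis
  proof
    assume G: "path_connected_graph G"
    have "invariantly_connected G" if "pverts G \<noteq> {}"
    proof (rule invariantly_connectedI)
      fix P :: "'a \<Rightarrow> bool" and x y
      assume inv: "P a = P b" if "(a, b) \<in> parcs G" for a b
      assume "x \<in> pverts G" "y \<in> pverts G"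
      then obtain p where p: "vwalk p (with_proj G)" "hd p = x" "last p = y"
        using G unfolding path_connected_graph_def by blast
      have "P (hd p) = P (last p)" using p(1) by (rule vwalk_invariant) (simp add: inv)
      then show "P x = P y" using p by simp
    qed (rule that)
    then show "pverts G = {} \<or> invariantly_connected G" by blast
  next
    assume G: "pverts G = {} \<or> invariantly_connected G"
    show "path_connected_graph G"
      unfolding path_connected_graph_def
    proof (intro ballI)
      fix x y assume xy: "x \<in> pverts G" "y \<in> pverts G"
      let ?P = "\<lambda>v. \<exists>p. vwalk p (with_proj G) \<and> hd p = x \<and> last p = v"
      have step: "?P b" if "?P a" "(a, b) \<in> parcs G" for a b
      proof -
        obtain p where p: "vwalk p (with_proj G)" "hd p = x" "last p = a" using \<open>?P a\<close> by auto
        have "vwalk (p @ [b]) (with_proj G)"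
          using p that(2) in_arcsD2[OF that(2)] by (intro vwalk_snoc) auto
        moreover have "p \<noteq> []" using p by auto
        ultimately show ?thesis using p by (intro exI[of _ "p @ [b]"]) auto
      qed
      have "?P x = ?P y"
      proof (rule invariantly_connectedD[of G ?P])
        fix a b assume "(a, b) \<in> parcs G"
        moreover from this have "(b, a) \<in> parcs G" using arcs_symmetric by auto
        ultimately show "?P a = ?P b" using step by blast
      next
        show "invariantly_connected G" using G xy by blast
      qed (use xy in simp_all)
      moreover have "?P x"
        using xy by (intro exI[of _ "[x]"]) (auto simp: vwalk_def)
      ultimately show "?P y" by blast
    qed
  qed
qed

section \<open>Splittings of the sub-base against splittings of the graph\<close>

lemma invariantly_connected_if_connected_cover:
  assumes conn: "connected_topological_graph G \<B> \<O>"
    and cover: "pverts G = \<Union> (pverts ` \<B>)" "pverts G \<noteq> {}"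
    and parcs: "\<And>B. B \<in> \<B> \<Longrightarrow> parcs B \<subseteq> parcs G"
    and inv_conn: "\<And>B. B \<in> \<B> \<Longrightarrow> invariantly_connected B"
  shows "invariantly_connected G"
proof (rule invariantly_connectedI)
  fix P :: "'a \<Rightarrow> bool" and x y
  assume inv: "P a = P b" if "(a, b) \<in> parcs G" for a b
  assume x: "x \<in> pverts G" and y: "y \<in> pverts G"
  \<comment> \<open>The two classes collect the elements on which \<open>P\<close> has the value
    \<open>P x\<close> and the other value. As \<open>P\<close> is constant on each connected
    element, every element falls into a class; a vertex common to both classes would have both
    values.\<close>
  define \<B>1 where "\<B>1 = {B \<in> \<B>. \<forall>v\<in>pverts B. P v = P x}"
  define \<B>2 where "\<B>2 = {B \<in> \<B>. \<forall>v\<in>pverts B. P v \<noteq> P x}"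
  have const: "P u = P v" if "B \<in> \<B>" "u \<in> pverts B" "v \<in> pverts B" for B u v
  proof (rule invariantly_connectedD[OF inv_conn[OF that(1)] _ that(2,3)])
    show "P a = P b" if "(a, b) \<in> parcs B" for a b
      using that parcs[OF \<open>B \<in> \<B>\<close>] by (intro inv) auto
  qed
  have all: "\<forall>v\<in>pverts B. P v = P u" if "B \<in> \<B>" "u \<in> pverts B" for B u
    using const[OF that(1) _ that(2)] by blast
  have union: "\<B> = \<B>1 \<union> \<B>2"
  proof (intro equalityI subsetI)
    fix B assume B: "B \<in> \<B>"
    show "B \<in> \<B>1 \<union> \<B>2"
    proof (cases "\<exists>u\<in>pverts B. P u = P x")
      case True
      then obtain u where u: "u \<in> pverts B" "P u = P x" by blast
      have "\<forall>v\<in>pverts B. P v = P x" using all[OF B u(1)] u(2) by simp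
      with B show ?thesis by (simp add: \<B>1_def)
    next
      case False
      with B show ?thesis by (simp add: \<B>2_def)
    qed
  qed (auto simp: \<B>1_def \<B>2_def)
  \<comment> \<open>An element through \<open>x\<close> makes the first class nonempty, so
    connectedness of the sub-base empties the second, and \<open>P\<close> equals \<open>P x\<close>
    on all that is covered.\<close>
  obtain B where B: "B \<in> \<B>" "x \<in> pverts B" using x cover(1) by auto
  then have "\<B>1 \<noteq> {}" using all[OF B] unfolding \<B>1_def by blast
  moreover have "\<forall>B1\<in>\<B>1. \<forall>B2\<in>\<B>2. pverts (graph_inter B1 B2) = {}"
    by (auto simp: \<B>1_def \<B>2_def graph_inter_def)
  ultimately have "\<B>2 = {}"
    using conn union unfolding connected_topological_graph_def by blast
  with union have "\<B> = \<B>1" by simp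
  moreover obtain C where "C \<in> \<B>" "y \<in> pverts C" using y cover(1) by auto
  ultimately show "P x = P y" unfolding \<B>1_def by blast
qed (rule cover(2))

text \<open>Given a splitting of the sub-base, membership in the region covered by one part is an
  invariant: each edge lies in a single element, hence has both ends on the same side. Nonempty
  elements in both parts supply vertices on both sides, a contradiction.\<close>

lemma connected_if_invariantly_connected:
  assumes conn: "invariantly_connected G"
    and subset: "\<And>B. B \<in> \<B> \<Longrightarrow> pverts B \<subseteq> pverts G"
    and nonempty: "\<And>B. B \<in> \<B> \<Longrightarrow> pverts B \<noteq> {}"
    and wf: "\<And>B. B \<in> \<B> \<Longrightarrow> pair_wf_digraph B"
    and edges: "\<And>e. e \<in> parcs G \<Longrightarrow> \<exists>B\<in>\<B>. e \<in> parcs B"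
  shows "connected_topological_graph G \<B> \<O>"
  unfolding connected_topological_graph_def
proof (rule notI, elim exE conjE)
  fix \<B>1 \<B>2
  assume B: "\<B> = \<B>1 \<union> \<B>2" and disj: "\<forall>B1\<in>\<B>1. \<forall>B2\<in>\<B>2. pverts (graph_inter B1 B2) = {}"
    and ne: "\<B>1 \<noteq> {}" "\<B>2 \<noteq> {}"
  define U where "U = \<Union> (pverts ` \<B>1)"
  have U2: "v \<notin> U" if "B2 \<in> \<B>2" "v \<in> pverts B2" for B2 v
    using disj that by (force simp: U_def graph_inter_def)
  obtain B1 B2 where "B1 \<in> \<B>1" "B2 \<in> \<B>2" using ne by auto
  moreover from this obtain x y where "x \<in> pverts B1" "y \<in> pverts B2"
    using nonempty B by blast
  ultimately have xy: "x \<in> pverts G" "y \<in> pverts G" "x \<in> U" "y \<notin> U"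
    using subset B U2 by (auto simp: U_def)
  have "(x \<in> U) = (y \<in> U)"
  proof (rule invariantly_connectedD[OF conn _ xy(1,2)])
    fix a b assume "(a, b) \<in> parcs G"
    then obtain C where C: "C \<in> \<B>" "(a, b) \<in> parcs C" using edges by blast
    interpret pair_wf_digraph C using wf C(1) by blast
    have "a \<in> pverts C" "b \<in> pverts C" using C(2) in_arcsD1 in_arcsD2 by blast+
    then show "(a \<in> U) = (b \<in> U)" using C(1) B U2 by (auto simp: U_def)
  qed
  with xy show False by blast
qed

theorem theorem6:
  fixes G :: "'a pair_pre_digraph"
    and \<B> :: "'a pair_pre_digraph set"
    and \<O> :: "'a topology"
  assumes "topological_graph G \<B> \<O>"
  shows "connected_topological_graph G \<B> \<O> \<longleftrightarrow> path_connected_graph G"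
proof -
  have G: "pair_graph G"
    and \<O>: "topspace \<O> = pverts G" "\<O> = topology_generated_by (pverts ` \<B>)"
    and B: "\<And>B. B \<in> \<B> \<Longrightarrow> pair_graph B"
      "\<And>B. B \<in> \<B> \<Longrightarrow> subgraph (with_proj B) (with_proj G)"
      "\<And>B. B \<in> \<B> \<Longrightarrow> contractible_graph B"
    and edges: "\<And>e. e \<in> parcs G \<Longrightarrow> \<exists>B\<in>\<B>. e \<in> parcs B"
    using assms unfolding topological_graph_def by blast+
  \<comment> \<open>This is what the topology contributes: its space is the union of the sub-base,
    so isolated vertices are covered too, which the edge condition alone would not give.\<close>
  have cover: "pverts G = \<Union> (pverts ` \<B>)"
    unfolding \<O>(1)[symmetric] unfolding \<O>(2) by (rule topology_generated_by_topspace)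
  note conn = contractible_graph_invariantly_connected[OF B(3)]
  have nonempty: "\<And>B. B \<in> \<B> \<Longrightarrow> pverts B \<noteq> {}"
    by (rule invariantly_connected_nonempty) (rule conn)
  have wf: "\<And>B. B \<in> \<B> \<Longrightarrow> pair_wf_digraph B"
    using B(1) by (simp add: pair_graph_def pair_digraph_def pair_fin_digraph_def)
  have parcs: "\<And>B. B \<in> \<B> \<Longrightarrow> parcs B \<subseteq> parcs G"
    using B(2) by (auto simp: subgraph_def)
  show ?thesis
  proof (cases "pverts G = {}")
    case True
    \<comment> \<open>Contractible graphs have a vertex, so none fits into the empty graph; both
      sides of the equivalence then hold vacuously.\<close>
    then have "\<B> = {}" using cover nonempty by auto
    with True show ?thesis
      by (simp add: connected_topological_graph_def path_connected_graph_def)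
  next
    case False
    have "connected_topological_graph G \<B> \<O> \<longleftrightarrow> invariantly_connected G"
    proof
      assume "connected_topological_graph G \<B> \<O>"
      then show "invariantly_connected G"
        using cover False parcs conn by (rule invariantly_connected_if_connected_cover)
    next
      assume "invariantly_connected G"
      then show "connected_topological_graph G \<B> \<O>"
        using cover nonempty wf edges by (intro connected_if_invariantly_connected) auto
    qed
    with path_connected_graph_iff_invariant[OF G] False show ?thesis by blast
  qed
qed

end
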